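(* Let $x^*$ be the unique root of the polynomial $p(x) = 8x^3 - 22x^2 + 10x - 1$ in $[0, 1/6]$. Then $\theta_{\mathrm{STS}}^f(\varepsilon) \leq 1 - x^* < 0.8579$ for every $\varepsilon \in [0, 1)$. In particular, $\theta_{\mathrm{STS}}^* \leq 1 - x^* < 0.8579$.
   Context: Let $H$ be a 3-uniform hypergraph. For a pair $p$ of vertices, $\deg(p)$ is the number of edges containing $p$. The shadow $\partial H$ is the graph on $V(H)$ whose edges are the pairs $p$ with $\deg(p)>0$; $\delta(\partial H)$ is its minimum degree. The essential minimum codegree is $\delta_2^{\mathrm{ess}}(H) = \min\{\deg(p) : p \text{ a pair with } \deg(p) > 0\}$. For $\psi\colon E(H)\to\mathbb{R}$ and a pair $p$, let $\deg^\psi(p) = \sum_{e \in E(H),\, p \subseteq e} \psi(e)$. A perfect fractional Steiner triple system in $H$ is a function $\psi\colon E(H) \to [0,1]$ with $\deg^\psi(p) = 1$ for every $p \in E(\partial H)$. For $\varepsilon \in [0,1]$, $\theta_{\mathrm{STS}}^f(\varepsilon)$ is the infimum of all $\delta \in [0,1]$ for which there exists $n_0$ such that every 3-uniform hypergraph $H$ on $n \geq n_0$ vertices with $\delta(\partial H) \geq (1-\varepsilon)(n-1)$ and $\delta_2^{\mathrm{ess}}(H) \geq \delta (n-2)$ contains a perfect fractional Steiner triple system. Finally, $\theta_{\mathrm{STS}}^* = \lim_{\varepsilon \downarrow 0} \theta_{\mathrm{STS}}^f(\varepsilon)$. *)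

theory Defs
  imports "HOL-Analysis.Analysis"
begin

definition uniform3_hypergraph :: "'a set \<Rightarrow> 'a set set \<Rightarrow> bool" where
  "uniform3_hypergraph V E \<longleftrightarrow> finite V \<and> (\<forall>e\<in>E. e \<subseteq> V \<and> card e = 3)"

definition pair_deg :: "'a set set \<Rightarrow> 'a set \<Rightarrow> nat" where
  "pair_deg E p = card {e \<in> E. p \<subseteq> e}"

definition shadow :: "'a set \<Rightarrow> 'a set set \<Rightarrow> 'a set set" where
  "shadow V E = {p. p \<subseteq> V \<and> card p = 2 \<and> pair_deg E p > 0}"

definition graph_min_degree :: "'a set \<Rightarrow> 'a set set \<Rightarrow> nat" where
  "graph_min_degree V G = Min ((\<lambda>v. card {p \<in> G. v \<in> p}) ` V)"

text \<open>
  For an edgeless hypergraph the minimum is over the empty set and the value is unspecified.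
  This does not affect the threshold below: an edgeless hypergraph has an empty shadow and
  therefore trivially contains a perfect fractional Steiner triple system.
\<close>
definition ess_min_codegree :: "'a set \<Rightarrow> 'a set set \<Rightarrow> nat" where
  "ess_min_codegree V E = Min {pair_deg E p | p. p \<subseteq> V \<and> card p = 2 \<and> pair_deg E p > 0}"

definition weighted_pair_deg :: "'a set set \<Rightarrow> ('a set \<Rightarrow> real) \<Rightarrow> 'a set \<Rightarrow> real" where
  "weighted_pair_deg E \<psi> p = (\<Sum>e | e \<in> E \<and> p \<subseteq> e. \<psi> e)"

definition perfect_fractional_STS :: "'a set \<Rightarrow> 'a set set \<Rightarrow> ('a set \<Rightarrow> real) \<Rightarrow> bool" where
  "perfect_fractional_STS V E \<psi> \<longleftrightarrow>
     (\<forall>e\<in>E. \<psi> e \<in> {0..1}) \<and> (\<forall>p\<in>shadow V E. weighted_pair_deg E \<psi> p = 1)"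

text \<open>
  Vertices are natural numbers; up to isomorphism this covers every finite hypergraph.
\<close>
definition STS_admissible :: "real \<Rightarrow> real \<Rightarrow> bool" where
  "STS_admissible \<epsilon> \<delta> \<longleftrightarrow>
     (\<exists>n\<^sub>0. \<forall>n\<ge>n\<^sub>0. \<forall>(V :: nat set) E.
        uniform3_hypergraph V E \<and> card V = n \<and>
        real (graph_min_degree V (shadow V E)) \<ge> (1 - \<epsilon>) * (real n - 1) \<and>
        real (ess_min_codegree V E) \<ge> \<delta> * (real n - 2)
        \<longrightarrow> (\<exists>\<psi>. perfect_fractional_STS V E \<psi>))"

definition theta_STS_f :: "real \<Rightarrow> real" where
  "theta_STS_f \<epsilon> = Inf {\<delta> \<in> {0..1}. STS_admissible \<epsilon> \<delta>}"

definition theta_STS_star :: real where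
  "theta_STS_star = Lim (at_right 0) theta_STS_f"

definition x_star :: real where
  "x_star = (THE x. x \<in> {0..1/6} \<and> 8 * x^3 - 22 * x^2 + 10 * x - 1 = 0)"

text \<open>
  The infimum is over a nonempty set and the limit exists, so that neither
  \<^const>\<open>theta_STS_f\<close> nor \<^const>\<open>theta_STS_star\<close> is a junk value.
\<close>

lemma pair_deg_le:
  assumes "uniform3_hypergraph V E" "p \<subseteq> V" "card p = 2"
  shows "pair_deg E p \<le> card V - 2"
proof -
  have fV: "finite V" using assms(1) by (simp add: uniform3_hypergraph_def)
  have fp: "finite p" using assms(2) fV finite_subset by blast
  have "{e \<in> E. p \<subseteq> e} \<subseteq> (\<lambda>w. insert w p) ` (V - p)"
  proof
    fix e assume "e \<in> {e \<in> E. p \<subseteq> e}"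
    then have e: "p \<subseteq> e" "e \<subseteq> V" "card e = 3"
      using assms(1) by (auto simp: uniform3_hypergraph_def)
    then have "card (e - p) = 1" using fp assms(3) by (simp add: card_Diff_subset)
    then obtain w where "e - p = {w}" by (auto simp: card_1_singleton_iff)
    then have "e = insert w p" "w \<in> V - p" using e by auto
    then show "e \<in> (\<lambda>w. insert w p) ` (V - p)" by blast
  qed
  then have "pair_deg E p \<le> card (V - p)"
    unfolding pair_deg_def using fV by (meson finite_Diff surj_card_le)
  then show ?thesis using fp assms by (simp add: card_Diff_subset)
qed

lemma STS_admissible_1: "STS_admissible \<epsilon> 1"
  unfolding STS_admissible_def
proof (intro exI[of _ 3] allI impI)
  fix n :: nat and V :: "nat set" and E
  assume n: "3 \<le> n"
    and H: "uniform3_hypergraph V E \<and> card V = n \<and>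
        (1 - \<epsilon>) * (real n - 1) \<le> real (graph_min_degree V (shadow V E)) \<and>
        1 * (real n - 2) \<le> real (ess_min_codegree V E)"
  have fV: "finite V" using H by (simp add: uniform3_hypergraph_def)
  have deg: "pair_deg E p = n - 2" if p: "p \<in> shadow V E" for p
  proof -
    have "finite {pair_deg E p | p. p \<subseteq> V \<and> card p = 2 \<and> pair_deg E p > 0}"
      using fV by auto
    then have "ess_min_codegree V E \<le> pair_deg E p"
      unfolding ess_min_codegree_def using p by (intro Min_le) (auto simp: shadow_def)
    then have "real n - 2 \<le> real (pair_deg E p)" using H by auto
    then have "n - 2 \<le> pair_deg E p" by linarith
    moreover have "pair_deg E p \<le> n - 2"
      using pair_deg_le[of V E p] H p by (auto simp: shadow_def)
    ultimately show ?thesis by simp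
  qed
  have "weighted_pair_deg E (\<lambda>_. 1 / real (n - 2)) p = 1" if "p \<in> shadow V E" for p
    using deg[OF that] n by (simp add: weighted_pair_deg_def pair_deg_def)
  then have "perfect_fractional_STS V E (\<lambda>_. 1 / real (n - 2))"
    using n by (auto simp: perfect_fractional_STS_def)
  then show "\<exists>\<psi>. perfect_fractional_STS V E \<psi>" by blast
qed

lemma STS_admissible_antimono:
  assumes "STS_admissible \<epsilon>' \<delta>" "\<epsilon> \<le> \<epsilon>'"
  shows "STS_admissible \<epsilon> \<delta>"
proof -
  obtain n\<^sub>0 where n0: "\<And>n (V :: nat set) E. n \<ge> n\<^sub>0 \<Longrightarrow>
        uniform3_hypergraph V E \<and> card V = n \<and>
        real (graph_min_degree V (shadow V E)) \<ge> (1 - \<epsilon>') * (real n - 1) \<and>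
        real (ess_min_codegree V E) \<ge> \<delta> * (real n - 2)
        \<Longrightarrow> (\<exists>\<psi>. perfect_fractional_STS V E \<psi>)"
    using assms(1) unfolding STS_admissible_def by blast
  have le: "(1 - \<epsilon>') * (real n - 1) \<le> (1 - \<epsilon>) * (real n - 1)" if "max n\<^sub>0 1 \<le> n" for n
    using that assms(2) by (intro mult_right_mono) auto
  show ?thesis
    unfolding STS_admissible_def
    by (rule exI[of _ "max n\<^sub>0 1"], intro allI impI, rule n0) (use le order_trans in auto)
qed

lemma theta_STS_f_mono: "\<epsilon> \<le> \<epsilon>' \<Longrightarrow> theta_STS_f \<epsilon> \<le> theta_STS_f \<epsilon>'"
  unfolding theta_STS_f_def
  by (rule cInf_superset_mono)
     (use STS_admissible_1 STS_admissible_antimono in \<open>auto intro!: exI[of _ 1] bdd_belowI[of _ 0]\<close>)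

lemma theta_STS_f_nonneg: "0 \<le> theta_STS_f \<epsilon>"
  unfolding theta_STS_f_def
  by (rule cInf_greatest) (use STS_admissible_1 in \<open>auto intro!: exI[of _ 1]\<close>)

lemma tendsto_theta_STS_star: "(theta_STS_f \<longlongrightarrow> theta_STS_star) (at_right 0)"
proof -
  have "(theta_STS_f \<longlongrightarrow> Inf (theta_STS_f ` ({0<..} \<inter> UNIV))) (at 0 within ({0<..} \<inter> UNIV))"
    by (rule Lim_right_bound[where K = 0]) (use theta_STS_f_mono theta_STS_f_nonneg in auto)
  then have "(theta_STS_f \<longlongrightarrow> Inf (theta_STS_f ` {0<..})) (at_right 0)" by simp
  then show ?thesis
    unfolding theta_STS_star_def by (metis tendsto_Lim trivial_limit_at_right_real)
qed

end

theory Submission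
  imports Defs
begin

text \<open>
  A codegree of at least \<open>(1 - x) (n - 2)\<close> with \<open>x < 1/7\<close> already suffices, for every \<open>n \<ge> 5\<close>, and
  \<open>x_star < 1/7\<close>. We look for a weighting \<open>f\<close> of all triples of \<open>V\<close>, including those
  outside \<open>E\<close>, such that for every shadow pair \<open>p\<close> the total weight of the triples through \<open>p\<close>
  is \<open>(n - 2) (1 + R p)\<close>, where \<open>(n - 2) R p\<close> is the weight of the non-edges through \<open>p\<close>; then the
  edges through \<open>p\<close> have total weight \<open>n - 2\<close>. In the complete 3-graph, prescribed pair degrees
  are realised by an explicit linear formula, which turns this requirement into a fixed point
  equation for \<open>f\<close>. If \<open>0 \<le> f \<le> 7/3\<close>, then \<open>0 \<le> R \<le> 1/3\<close>, and the formula gives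
  \<open>1 - 3 (1/3) \<le> f \<le> 1 + 4 (1/3)\<close> again. The map is a contraction with factor \<open>7 x\<close>,
  so it has a fixed point in this box.
\<close>

section \<open>Weightings of all triples with prescribed pair degrees\<close>

definition vertex_pairs :: "'a set \<Rightarrow> 'a set set" where
  "vertex_pairs V = {p. p \<subseteq> V \<and> card p = 2}"

text \<open>
  The matrix with entries \<open>inv_coeff n (card (p \<inter> T)) / (n - 2)\<close> is a right inverse of the
  pair-triple inclusion matrix on \<open>n\<close> points; the three values are forced by symmetry.
\<close>
definition inv_coeff :: "nat \<Rightarrow> nat \<Rightarrow> real" where
  "inv_coeff n i = (if i = 2 then 1 else if i = 1 then - 1 / (real n - 3)
     else 2 / ((real n - 3) * (real n - 4)))"

text \<open>Pairs outside the shadow impose no degree condition, and every triple through them is a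
  non-edge. The value 0 keeps the share small there too, where the quotient could be as large as the
  maximum of \<open>f\<close>.\<close>

definition nonedge_share :: "'a set \<Rightarrow> 'a set set \<Rightarrow> ('a set \<Rightarrow> real) \<Rightarrow> 'a set \<Rightarrow> real" where
  "nonedge_share V E f p =
     (if p \<in> shadow V E
      then (\<Sum>c | c \<in> V - p \<and> insert c p \<notin> E. f (insert c p)) / (real (card V) - 2) else 0)"

text \<open>The constant 1 gives every pair degree n - 2, and the sum adds (n - 2) R p. The factor n
  - 2 of this prescribed degree cancels the denominator n - 2 of the right inverse.\<close>

definition rebalance :: "'a set \<Rightarrow> 'a set set \<Rightarrow> ('a set \<Rightarrow> real) \<Rightarrow> 'a set \<Rightarrow> real" where
  "rebalance V E f T =
     1 + (\<Sum>p\<in>vertex_pairs V. inv_coeff (card V) (card (p \<inter> T)) * nonedge_share V E f p)"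

lemma finite_vertex_pairs: "finite V \<Longrightarrow> finite (vertex_pairs V)"
  by (simp add: vertex_pairs_def)

text \<open>With j common points of p and q, there are 2 - j choices of c in p - q, which raise the
  intersection to j + 1, and n - 4 + j choices that leave it at j. The coefficients balance for j =
  0 and j = 1.\<close>

lemma sum_inv_coeff_through_pair:
  assumes V: "finite V" "card V \<ge> 5" and p: "p \<in> vertex_pairs V" and q: "q \<in> vertex_pairs V"
  shows "(\<Sum>c\<in>V - q. inv_coeff (card V) (card (p \<inter> insert c q)))
       = (if p = q then real (card V) - 2 else 0)"
proof -
  let ?n = "card V" and ?j = "card (p \<inter> q)"
  have fin: "finite p" "finite q" and sub: "p \<subseteq> V" "q \<subseteq> V" and c2: "card p = 2" "card q = 2"
    using p q V finite_subset by (auto simp: vertex_pairs_def)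
  have j2: "?j \<le> 2" using fin c2 by (metis card_mono inf_le1)
  have eqj: "p = q" if "?j = 2"
    using that fin c2 by (metis card_subset_eq inf_le1 inf_le2)
  have split: "V - q = (p - q) \<union> (V - q - p)" using sub by auto
  have c1: "card (p - q) = 2 - ?j"
    using fin c2 by (simp add: card_Diff_subset_Int)
  have "card (V - q) = ?n - 2" using fin sub c2 by (simp add: card_Diff_subset)
  moreover have "card (V - q) = card (p - q) + card (V - q - p)"
    by (subst split, rule card_Un_disjoint) (use V fin in auto)
  ultimately have c3: "card (V - q - p) = ?n - 2 - (2 - ?j)" using c1 by simp
  have in1: "card (p \<inter> insert c q) = Suc ?j" if "c \<in> p - q" for c
    using that fin by (simp add: Int_insert_right)
  have in0: "card (p \<inter> insert c q) = ?j" if "c \<in> V - q - p" for c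
    using that by (simp add: Int_insert_right)
  have "(\<Sum>c\<in>V - q. inv_coeff ?n (card (p \<inter> insert c q)))
      = (\<Sum>c\<in>p - q. inv_coeff ?n (card (p \<inter> insert c q)))
        + (\<Sum>c\<in>V - q - p. inv_coeff ?n (card (p \<inter> insert c q)))"
    by (subst split, rule sum.union_disjoint) (use V fin in auto)
  \<comment> \<open>For j = 2 the argument \<open>Suc ?j\<close> is 3 and \<open>inv_coeff\<close>
    takes its default branch, but the multiplicity \<open>2 - ?j\<close> is then 0.\<close>
  also have "\<dots> = real (2 - ?j) * inv_coeff ?n (Suc ?j)
        + real (?n - 2 - (2 - ?j)) * inv_coeff ?n ?j"
    using in1 in0 c1 c3 by simp
  also have "\<dots> = (if p = q then real ?n - 2 else 0)"
  proof -
    consider "?j = 0" | "?j = 1" | "?j = 2" using j2 by linarith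
    then show ?thesis
    proof cases
      case 1
      then have "p \<noteq> q" using c2 by auto
      moreover have "b * (2 / (a * b)) = 2 / a" if "b \<noteq> 0" for a b :: real using that by simp
      from this[of "real ?n - 4" "real ?n - 3"]
      have "real (?n - 2 - 2) * (2 / ((real ?n - 3) * (real ?n - 4))) = 2 / (real ?n - 3)"
        using V by (simp add: of_nat_diff del: times_divide_eq_right)
      ultimately show ?thesis
        using 1 by (simp add: inv_coeff_def del: times_divide_eq_right)
    next
      case 2
      then have "p \<noteq> q" using c2 by auto
      with 2 show ?thesis using V by (simp add: inv_coeff_def field_simps of_nat_diff)
    next
      case 3
      with eqj show ?thesis using V by (simp add: inv_coeff_def of_nat_diff)
    qed
  qed
  finally show ?thesis .
qed

text \<open>Exchanging the two sums leaves only the term p = q. This holds for any \<open>f\<close>;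
  at a fixed point the left side becomes the degree of \<open>f\<close> itself.\<close>

lemma sum_rebalance_through_pair:
  assumes V: "finite V" "card V \<ge> 5" and q: "q \<in> vertex_pairs V"
  shows "(\<Sum>c\<in>V - q. rebalance V E f (insert c q))
       = (real (card V) - 2) * (1 + nonedge_share V E f q)"
proof -
  let ?n = "card V"
  have "finite q" "q \<subseteq> V" "card q = 2"
    using q V finite_subset by (auto simp: vertex_pairs_def)
  then have cq: "real (card (V - q)) = real ?n - 2"
    using V by (simp add: card_Diff_subset of_nat_diff)
  have "(\<Sum>c\<in>V - q. \<Sum>p\<in>vertex_pairs V.
            inv_coeff ?n (card (p \<inter> insert c q)) * nonedge_share V E f p)
      = (\<Sum>p\<in>vertex_pairs V.
            (\<Sum>c\<in>V - q. inv_coeff ?n (card (p \<inter> insert c q))) * nonedge_share V E f p)"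
    by (subst sum.swap) (simp add: sum_distrib_right)
  also have "\<dots> = (\<Sum>p\<in>vertex_pairs V.
            if p = q then (real ?n - 2) * nonedge_share V E f p else 0)"
    by (intro sum.cong) (auto simp: sum_inv_coeff_through_pair[OF V _ q])
  also have "\<dots> = (real ?n - 2) * nonedge_share V E f q"
    using q finite_vertex_pairs[OF V(1)] by simp
  finally show ?thesis
    by (simp add: rebalance_def sum.distrib cq algebra_simps)
qed

section \<open>Range of the linear formula\<close>

lemma card_vertex_pairs_meeting_triple:
  assumes V: "finite V" and T: "T \<subseteq> V" "card T = 3"
  shows "card {p \<in> vertex_pairs V. card (p \<inter> T) = 2} = 3"
    and "card {p \<in> vertex_pairs V. card (p \<inter> T) = 1} = 3 * (card V - 3)"
    and "card {p \<in> vertex_pairs V. card (p \<inter> T) = 0} = (card V - 3) choose 2"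
proof -
  have fp: "finite p" if "p \<in> vertex_pairs V" for p
    using that V finite_subset by (auto simp: vertex_pairs_def)
  have fT: "finite T" using V T finite_subset by blast
  have "{p \<in> vertex_pairs V. card (p \<inter> T) = 2} = {p. p \<subseteq> T \<and> card p = 2}"
  proof (intro set_eqI iffI)
    fix p assume p: "p \<in> {p \<in> vertex_pairs V. card (p \<inter> T) = 2}"
    then have "p \<inter> T = p"
      using fp[of p] by (intro card_subset_eq) (auto simp: vertex_pairs_def)
    then show "p \<in> {p. p \<subseteq> T \<and> card p = 2}" using p by (auto simp: vertex_pairs_def)
  next
    fix p assume "p \<in> {p. p \<subseteq> T \<and> card p = 2}"
    then show "p \<in> {p \<in> vertex_pairs V. card (p \<inter> T) = 2}"
      using T by (auto simp: vertex_pairs_def Int_absorb2)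
  qed
  then show "card {p \<in> vertex_pairs V. card (p \<inter> T) = 2} = 3"
    using n_subsets[OF fT, of 2] T by (simp add: choose_two)
  have "{p \<in> vertex_pairs V. card (p \<inter> T) = 0} = {p. p \<subseteq> V - T \<and> card p = 2}"
    using fT by (auto simp: vertex_pairs_def)
  then show "card {p \<in> vertex_pairs V. card (p \<inter> T) = 0} = (card V - 3) choose 2"
    using n_subsets[of "V - T" 2] V T fT by (simp add: card_Diff_subset)
  have "{p \<in> vertex_pairs V. card (p \<inter> T) = 1} = (\<lambda>(a, b). {a, b}) ` (T \<times> (V - T))"
  proof (intro set_eqI iffI)
    fix p assume "p \<in> {p \<in> vertex_pairs V. card (p \<inter> T) = 1}"
    then have p: "p \<subseteq> V" "card p = 2" "card (p \<inter> T) = 1" by (auto simp: vertex_pairs_def)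
    then obtain a where a: "p \<inter> T = {a}" by (auto simp: card_1_singleton_iff)
    obtain b where "p = {a, b}" "b \<noteq> a"
      using p(2) a by (metis Int_iff card_2_iff doubleton_eq_iff insert_iff singletonD singletonI)
    then show "p \<in> (\<lambda>(a, b). {a, b}) ` (T \<times> (V - T))" using a p by auto
  next
    fix p assume "p \<in> (\<lambda>(a, b). {a, b}) ` (T \<times> (V - T))"
    then obtain a b where ab: "a \<in> T" "b \<in> V - T" "p = {a, b}" by auto
    then have "p \<inter> T = {a}" "a \<noteq> b" by auto
    then show "p \<in> {p \<in> vertex_pairs V. card (p \<inter> T) = 1}"
      using ab T by (auto simp: vertex_pairs_def)
  qed
  moreover have "inj_on (\<lambda>(a, b). {a, b}) (T \<times> (V - T))"
    by (auto simp: inj_on_def doubleton_eq_iff)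
  ultimately show "card {p \<in> vertex_pairs V. card (p \<inter> T) = 1} = 3 * (card V - 3)"
    using V T fT by (simp add: card_image card_cartesian_product card_Diff_subset)
qed

text \<open>Multiplying the three coefficients by the numbers of pairs that carry them gives total
  weights 3, -3 and 1, independent of n. The positive part weighs 4 and the negative part 3. For l =
  -u the bound is 7 u, the source of the constant 7.\<close>

lemma sum_inv_coeff_bounds:
  assumes V: "finite V" "card V \<ge> 5" and T: "T \<subseteq> V" "card T = 3"
    and R: "\<And>p. p \<in> vertex_pairs V \<Longrightarrow> l \<le> R p \<and> R p \<le> u"
  shows "(\<Sum>p\<in>vertex_pairs V. inv_coeff (card V) (card (p \<inter> T)) * R p)
    \<in> {4 * l - 3 * u..4 * u - 3 * l}"
proof -
  let ?n = "card V"
  define P where "P i = {p \<in> vertex_pairs V. card (p \<inter> T) = i}" for i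
  have fP: "finite (P i)" for i by (simp add: P_def finite_vertex_pairs V)
  have "card (p \<inter> T) \<le> 2" if "p \<in> vertex_pairs V" for p
  proof -
    have "finite p" "card p = 2" using that V finite_subset by (auto simp: vertex_pairs_def)
    then show ?thesis by (metis card_mono inf_le1)
  qed
  then have un: "vertex_pairs V = P 2 \<union> (P 1 \<union> P 0)"
    by (fastforce simp: P_def le_Suc_eq numeral_2_eq_2)
  have cards: "card (P 2) = 3" "card (P 1) = 3 * (?n - 3)" "card (P 0) = (?n - 3) choose 2"
    using card_vertex_pairs_meeting_triple[OF V(1) T] by (auto simp: P_def)
  define S where "S i = (\<Sum>p\<in>P i. R p)" for i
  have S: "real (card (P i)) * l \<le> S i" "S i \<le> real (card (P i)) * u" for i
    unfolding S_def using R by (auto simp: P_def intro!: sum_bounded_below sum_bounded_above)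
  have "(\<Sum>p\<in>vertex_pairs V. inv_coeff ?n (card (p \<inter> T)) * R p)
      = (\<Sum>p\<in>P 2. inv_coeff ?n (card (p \<inter> T)) * R p)
        + ((\<Sum>p\<in>P 1. inv_coeff ?n (card (p \<inter> T)) * R p)
        + (\<Sum>p\<in>P 0. inv_coeff ?n (card (p \<inter> T)) * R p))"
    unfolding un by (subst sum.union_disjoint; (use fP in \<open>auto simp: P_def\<close>)?)+
  also have "\<dots> = inv_coeff ?n 2 * S 2 + (inv_coeff ?n 1 * S 1 + inv_coeff ?n 0 * S 0)"
    by (simp add: P_def S_def sum_distrib_left)
  also have "\<dots> = S 2 - S 1 / (real ?n - 3) + S 0 * 2 / ((real ?n - 3) * (real ?n - 4))"
    by (simp add: inv_coeff_def)
  finally have eq: "(\<Sum>p\<in>vertex_pairs V. inv_coeff ?n (card (p \<inter> T)) * R p) = \<dots>" .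
  have "3 * l \<le> S 2" "S 2 \<le> 3 * u" using S[of 2] cards by auto
  moreover have "3 * l \<le> S 1 / (real ?n - 3)" "S 1 / (real ?n - 3) \<le> 3 * u"
    using S[of 1] cards V by (auto simp: field_simps of_nat_diff)
  moreover have "l \<le> S 0 * 2 / ((real ?n - 3) * (real ?n - 4))"
    "S 0 * 2 / ((real ?n - 3) * (real ?n - 4)) \<le> u"
  proof -
    have pos: "0 < (real ?n - 3) * (real ?n - 4)" using V by simp
    have c0: "real ((?n - 3) choose 2) = (real ?n - 3) * (real ?n - 4) / 2"
      using V by (simp add: choose_two real_of_nat_div of_nat_diff)
    show "l \<le> S 0 * 2 / ((real ?n - 3) * (real ?n - 4))"
      "S 0 * 2 / ((real ?n - 3) * (real ?n - 4)) \<le> u"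
      using S[of 0] unfolding cards(3) c0 pos_le_divide_eq[OF pos] pos_divide_le_eq[OF pos]
      by (simp_all add: mult.commute)
  qed
  ultimately show ?thesis unfolding eq by auto
qed

section \<open>Fixed points of contractions in a box\<close>

text \<open>
  Since the box has width \<open>B\<close>, any two points of it are at distance at most \<open>B q ^ k\<close> after \<open>k\<close>
  iterations, so the orbit of \<open>0\<close> converges uniformly.
\<close>
lemma fixpoint_of_contraction_in_box:
  fixes \<Phi> :: "('a \<Rightarrow> real) \<Rightarrow> 'a \<Rightarrow> real"
  assumes q: "0 \<le> q" "q < 1" and B: "0 \<le> B"
    and contr: "\<And>f g d. 0 \<le> d \<Longrightarrow> \<forall>t\<in>X. \<bar>f t - g t\<bar> \<le> d \<Longrightarrow> \<forall>t\<in>X. \<bar>\<Phi> f t - \<Phi> g t\<bar> \<le> q * d"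
    and box: "\<And>f. \<forall>t\<in>X. f t \<in> {0..B} \<Longrightarrow> \<forall>t\<in>X. \<Phi> f t \<in> {0..B}"
  obtains f where "\<forall>t\<in>X. f t \<in> {0..B}" "\<forall>t\<in>X. \<Phi> f t = f t"
proof -
  define g where "g k = (\<Phi> ^^ k) (\<lambda>_. 0)" for k
  have gS: "g (Suc k) = \<Phi> (g k)" for k by (simp add: g_def)
  have g_box: "\<forall>t\<in>X. g k t \<in> {0..B}" for k
  proof (induction k)
    case 0
    show ?case using B by (simp add: g_def)
  next
    case (Suc k)
    then show ?case unfolding gS by (rule box)
  qed
  have g_diff: "\<forall>t\<in>X. \<bar>g (k + m) t - g k t\<bar> \<le> B * q ^ k" for k m
  proof (induction k)
    case 0
    show ?case using g_box[of m] by (simp add: g_def)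
  next
    case (Suc k)
    from contr[OF _ this] show ?case using q B by (simp add: gS mult.left_commute)
  qed
  have q0: "(\<lambda>k. B * q ^ k) \<longlonglongrightarrow> 0"
    using q by (intro tendsto_mult_right_zero LIMSEQ_realpow_zero) auto
  have lim: "(\<lambda>k. g k t) \<longlonglongrightarrow> lim (\<lambda>k. g k t)" if t: "t \<in> X" for t
  proof -
    have "Cauchy (\<lambda>k. g k t)"
    proof (rule metric_CauchyI)
      fix e :: real assume "0 < e"
      then obtain M where M: "B * q ^ M < e / 2"
        using order_tendstoD(2)[OF q0, of "e / 2"] by (auto simp: eventually_sequentially)
      have "dist (g m t) (g M t) < e / 2" if "M \<le> m" for m
        using g_diff[of M "m - M"] t M that by (auto simp: dist_real_def)
      then have "\<forall>m\<ge>M. \<forall>n\<ge>M. dist (g m t) (g n t) < e"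
        by (meson dist_triangle_half_l dist_commute)
      then show "\<exists>M. \<forall>m\<ge>M. \<forall>n\<ge>M. dist (g m t) (g n t) < e" by blast
    qed
    then show ?thesis using Cauchy_convergent convergent_LIMSEQ_iff by blast
  qed
  define f where "f t = lim (\<lambda>k. g k t)" for t
  have f_lim: "(\<lambda>k. g k t) \<longlonglongrightarrow> f t" if "t \<in> X" for t using lim[OF that] by (simp add: f_def)
  have f_box: "\<forall>t\<in>X. f t \<in> {0..B}"
    using g_box LIMSEQ_le_const[OF f_lim] LIMSEQ_le_const2[OF f_lim] by (auto; blast)
  \<comment> \<open>Let m tend to infinity in \<open>g_diff\<close>.\<close>
  have f_diff: "\<forall>t\<in>X. \<bar>f t - g k t\<bar> \<le> B * q ^ k" for k
  proof
    fix t assume t: "t \<in> X"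
    have "(\<lambda>m. \<bar>g (k + m) t - g k t\<bar>) \<longlonglongrightarrow> \<bar>f t - g k t\<bar>"
      using LIMSEQ_ignore_initial_segment[OF f_lim[OF t], of k]
      by (intro tendsto_intros) (simp add: add.commute)
    then show "\<bar>f t - g k t\<bar> \<le> B * q ^ k"
      by (rule LIMSEQ_le_const2) (use g_diff t in auto)
  qed
  have "\<Phi> f t = f t" if t: "t \<in> X" for t
  proof -
    \<comment> \<open>The bound \<open>f_diff\<close> is uniform on \<open>X\<close>, so
      \<open>contr\<close> applies to \<open>f\<close> and \<open>g k\<close> and shows that the
      iterates also tend to \<open>\<Phi> f\<close>.\<close>
    have "(\<lambda>k. g (Suc k) t) \<longlonglongrightarrow> \<Phi> f t"
    proof (rule LIM_zero_cancel, rule Lim_null_comparison)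
      show "\<forall>\<^sub>F k in sequentially. norm (g (Suc k) t - \<Phi> f t) \<le> q * (B * q ^ k)"
        using contr[OF _ f_diff] t q B by (auto simp: gS abs_minus_commute)
      show "(\<lambda>k. q * (B * q ^ k)) \<longlonglongrightarrow> 0" by (rule tendsto_mult_right_zero[OF q0])
    qed
    then show ?thesis using LIMSEQ_Suc[OF f_lim[OF t]] LIMSEQ_unique by blast
  qed
  with f_box that show thesis by blast
qed

section \<open>Non-edges through a pair\<close>

lemma edges_through_pair:
  assumes "uniform3_hypergraph V E" "p \<in> vertex_pairs V"
  shows "{e \<in> E. p \<subseteq> e} = (\<lambda>c. insert c p) ` {c \<in> V - p. insert c p \<in> E}"
    and "inj_on (\<lambda>c. insert c p) {c \<in> V - p. insert c p \<in> E}"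
proof -
  have fp: "finite p" "card p = 2" using assms(2) by (auto simp: vertex_pairs_def card_ge_0_finite)
  show "{e \<in> E. p \<subseteq> e} = (\<lambda>c. insert c p) ` {c \<in> V - p. insert c p \<in> E}"
  proof (intro set_eqI iffI)
    fix e assume "e \<in> {e \<in> E. p \<subseteq> e}"
    then have e: "e \<in> E" "p \<subseteq> e" "e \<subseteq> V" "card e = 3"
      using assms(1) by (auto simp: uniform3_hypergraph_def)
    then have "card (e - p) = 1" using fp by (simp add: card_Diff_subset)
    then obtain c where "e - p = {c}" by (auto simp: card_1_singleton_iff)
    then have "e = insert c p" "c \<in> V - p" using e by auto
    then show "e \<in> (\<lambda>c. insert c p) ` {c \<in> V - p. insert c p \<in> E}" using e by blast
  qed auto
  show "inj_on (\<lambda>c. insert c p) {c \<in> V - p. insert c p \<in> E}" by (auto simp: inj_on_def)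
qed

lemma card_nonedges_through_pair:
  assumes H: "uniform3_hypergraph V E" and V: "card V \<ge> 5" and p: "p \<in> vertex_pairs V"
  shows "real (card {c \<in> V - p. insert c p \<notin> E}) = real (card V) - 2 - real (pair_deg E p)"
proof -
  have fV: "finite V" using H by (simp add: uniform3_hypergraph_def)
  have "pair_deg E p = card {c \<in> V - p. insert c p \<in> E}"
    unfolding pair_deg_def edges_through_pair(1)[OF H p]
    by (rule card_image[OF edges_through_pair(2)[OF H p]])
  moreover have "card (V - p) = card V - 2"
    using p by (auto simp: vertex_pairs_def card_Diff_subset card_ge_0_finite)
  moreover have "card (V - p) = card ({c \<in> V - p. insert c p \<in> E} \<union> {c \<in> V - p. insert c p \<notin> E})"
    by (rule arg_cong[of _ _ card]) auto
  moreover have "\<dots> = card {c \<in> V - p. insert c p \<in> E} + card {c \<in> V - p. insert c p \<notin> E}"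
    using fV by (intro card_Un_disjoint) auto
  ultimately show ?thesis using V by linarith
qed

text \<open>At most x (n - 2) triples through a shadow pair are non-edges. Only this upper bound on
  their number is available, hence the signs of l and u. The case l = 0 serves the box, l = -u the
  contraction.\<close>

lemma nonedge_share_bounds:
  assumes H: "uniform3_hypergraph V E" and V: "card V \<ge> 5" and p: "p \<in> vertex_pairs V"
    and deg: "\<And>p. p \<in> shadow V E \<Longrightarrow> (1 - x) * (real (card V) - 2) \<le> real (pair_deg E p)"
    and x: "0 \<le> x" and lu: "l \<le> 0" "0 \<le> u"
    and f: "\<And>T. T \<subseteq> V \<Longrightarrow> card T = 3 \<Longrightarrow> l \<le> f T \<and> f T \<le> u"
  shows "x * l \<le> nonedge_share V E f p \<and> nonedge_share V E f p \<le> x * u"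
proof (cases "p \<in> shadow V E")
  case False
  then show ?thesis using x lu by (simp add: nonedge_share_def mult_nonneg_nonpos)
next
  case True
  let ?C = "{c \<in> V - p. insert c p \<notin> E}"
  have C: "real (card ?C) \<le> x * (real (card V) - 2)"
    using card_nonedges_through_pair[OF H V p] deg[OF True] by (simp add: algebra_simps)
  have fc: "l \<le> f (insert c p) \<and> f (insert c p) \<le> u" if "c \<in> ?C" for c
  proof (rule f)
    show "insert c p \<subseteq> V" using that p by (auto simp: vertex_pairs_def)
    show "card (insert c p) = 3" using that p by (auto simp: vertex_pairs_def card_ge_0_finite)
  qed
  have "(\<Sum>c\<in>?C. f (insert c p)) \<le> real (card ?C) * u"
    using fc by (intro sum_bounded_above) auto
  also have "\<dots> \<le> x * (real (card V) - 2) * u" using C lu by (intro mult_right_mono)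
  finally have 1: "(\<Sum>c\<in>?C. f (insert c p)) \<le> x * (real (card V) - 2) * u" .
  have "x * (real (card V) - 2) * l \<le> real (card ?C) * l"
    using C lu by (intro mult_right_mono_neg)
  also have "\<dots> \<le> (\<Sum>c\<in>?C. f (insert c p))"
    using fc by (intro sum_bounded_below) auto
  finally have 2: "x * (real (card V) - 2) * l \<le> (\<Sum>c\<in>?C. f (insert c p))" .
  from 1 2 True V show ?thesis by (simp add: nonedge_share_def field_simps)
qed

text \<open>The share is linear in \<open>f\<close>, so the constant 1 cancels and the bounds on the
  linear part give the contraction estimate.\<close>

lemma rebalance_diff:
  "rebalance V E f T - rebalance V E g T
     = (\<Sum>p\<in>vertex_pairs V. inv_coeff (card V) (card (p \<inter> T)) * nonedge_share V E (\<lambda>t. f t - g t) p)"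
proof -
  have "nonedge_share V E (\<lambda>t. f t - g t) p = nonedge_share V E f p - nonedge_share V E g p" for p
    by (simp add: nonedge_share_def sum_subtractf diff_divide_distrib)
  then show ?thesis by (simp add: rebalance_def right_diff_distrib sum_subtractf)
qed

section \<open>A sufficient codegree condition\<close>

theorem perfect_fractional_STS_if_codegree:
  assumes H: "uniform3_hypergraph V E" and V: "card V \<ge> 5" and x: "0 \<le> x" "x < 1/7"
    and deg: "\<And>p. p \<in> shadow V E \<Longrightarrow> (1 - x) * (real (card V) - 2) \<le> real (pair_deg E p)"
  shows "\<exists>\<psi>. perfect_fractional_STS V E \<psi>"
proof -
  have fV: "finite V" using H by (simp add: uniform3_hypergraph_def)
  let ?X = "{T. T \<subseteq> V \<and> card T = 3}" and ?N = "real (card V) - 2"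
  have N: "?N > 0" using V by simp
  \<comment> \<open>With x = 1/7 and box [0, B] the share is at most B/7. The choice B = 7/3 solves
    both 1 - 3 B/7 = 0 and 1 + 4 B/7 = B.\<close>
  obtain f where f_box: "\<forall>t\<in>?X. f t \<in> {0..7/3}" and f_fix: "\<forall>t\<in>?X. rebalance V E f t = f t"
  proof (rule fixpoint_of_contraction_in_box[of "7 * x" "7/3" ?X "rebalance V E"])
    fix f g :: "'a set \<Rightarrow> real" and d :: real
    assume d: "0 \<le> d" "\<forall>t\<in>?X. \<bar>f t - g t\<bar> \<le> d"
    have share: "x * (- d) \<le> nonedge_share V E (\<lambda>t. f t - g t) p
        \<and> nonedge_share V E (\<lambda>t. f t - g t) p \<le> x * d" if "p \<in> vertex_pairs V" for p
      using d by (intro nonedge_share_bounds[OF H V that deg x(1)]) (force simp: abs_le_iff)+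
    show "\<forall>t\<in>?X. \<bar>rebalance V E f t - rebalance V E g t\<bar> \<le> 7 * x * d"
    proof
      fix t assume "t \<in> ?X"
      then show "\<bar>rebalance V E f t - rebalance V E g t\<bar> \<le> 7 * x * d"
        using sum_inv_coeff_bounds[OF fV V, of t "x * (- d)"
            "nonedge_share V E (\<lambda>t. f t - g t)" "x * d"] share
        unfolding rebalance_diff by (auto simp: abs_le_iff mult_ac)
    qed
  next
    fix f :: "'a set \<Rightarrow> real" assume f: "\<forall>t\<in>?X. f t \<in> {0..7/3}"
    have share: "0 \<le> nonedge_share V E f p \<and> nonedge_share V E f p \<le> 1/3"
      if "p \<in> vertex_pairs V" for p
      using nonedge_share_bounds[OF H V that deg x(1), of 0 "7/3" f] f x by auto
    show "\<forall>t\<in>?X. rebalance V E f t \<in> {0..7/3}"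
    proof
      fix t assume "t \<in> ?X"
      then show "rebalance V E f t \<in> {0..7/3}"
        using sum_inv_coeff_bounds[OF fV V, of t 0 "nonedge_share V E f" "1/3"] share
        by (auto simp: rebalance_def)
    qed
  qed (use x in auto)
  define \<psi> where "\<psi> T = f T / ?N" for T
  have nonneg: "0 \<le> \<psi> e" if "e \<in> E" for e
    using that H f_box N by (auto simp: \<psi>_def uniform3_hypergraph_def)
  have one: "weighted_pair_deg E \<psi> p = 1" if "p \<in> shadow V E" for p
  proof -
    have p: "p \<in> vertex_pairs V" using that by (auto simp: shadow_def vertex_pairs_def)
    let ?C = "{c \<in> V - p. insert c p \<in> E}" and ?D = "{c \<in> V - p. insert c p \<notin> E}"
    have "?N * (1 + nonedge_share V E f p) = (\<Sum>c\<in>V - p. rebalance V E f (insert c p))"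
      using sum_rebalance_through_pair[OF fV V p] by simp
    also have "\<dots> = (\<Sum>c\<in>V - p. f (insert c p))"
    proof (intro sum.cong refl)
      fix c assume "c \<in> V - p"
      then have "insert c p \<in> ?X" using p by (auto simp: vertex_pairs_def card_ge_0_finite)
      then show "rebalance V E f (insert c p) = f (insert c p)" using f_fix by blast
    qed
    also have "\<dots> = (\<Sum>c\<in>?C \<union> ?D. f (insert c p))" by (rule sum.cong) auto
    also have "\<dots> = (\<Sum>c\<in>?C. f (insert c p)) + (\<Sum>c\<in>?D. f (insert c p))"
      using fV by (intro sum.union_disjoint) auto
    \<comment> \<open>Here p lies in the shadow, so \<open>nonedge_share\<close> is the actual
      quotient and not its default 0. The non-edge weight then cancels the surplus in the
      degree.\<close>
    also have "(\<Sum>c\<in>?D. f (insert c p)) = ?N * nonedge_share V E f p"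
      using that N by (simp add: nonedge_share_def)
    finally have "(\<Sum>c\<in>?C. f (insert c p)) = ?N" by (simp add: algebra_simps)
    then have "(\<Sum>c\<in>?C. \<psi> (insert c p)) = 1"
      using N by (simp add: \<psi>_def flip: sum_divide_distrib)
    then show ?thesis
      using edges_through_pair[OF H p]
      by (simp add: weighted_pair_deg_def sum.reindex o_def)
  qed
  \<comment> \<open>The bound 1 comes from the degrees and not from the box: e contains a shadow
    pair, and the nonnegative weights through that pair sum to 1.\<close>
  have "\<psi> e \<le> 1" if e: "e \<in> E" for e
  proof -
    have eV: "e \<subseteq> V" "card e = 3" using e H by (auto simp: uniform3_hypergraph_def)
    obtain p where p: "p \<subseteq> e" "card p = 2"
    proof (rule obtain_subset_with_card_n)
      show "2 \<le> card e" using eV by simp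
    qed
    have fin: "finite {e \<in> E. p \<subseteq> e}"
      using H fV by (auto simp: uniform3_hypergraph_def intro: finite_subset[of _ "Pow V"])
    then have "pair_deg E p > 0" using e p by (auto simp: pair_deg_def card_gt_0_iff)
    then have "p \<in> shadow V E" using p eV by (auto simp: shadow_def)
    moreover have "\<psi> e \<le> weighted_pair_deg E \<psi> p"
      unfolding weighted_pair_deg_def using fin e p nonneg by (intro member_le_sum) auto
    ultimately show ?thesis using one by simp
  qed
  with nonneg one show ?thesis by (auto simp: perfect_fractional_STS_def)
qed

section \<open>Admissible thresholds and the root of the cubic\<close>

lemma ess_min_codegree_le:
  assumes "finite V" "p \<in> shadow V E"
  shows "ess_min_codegree V E \<le> pair_deg E p"
  unfolding ess_min_codegree_def using assms by (intro Min_le) (auto simp: shadow_def)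

lemma STS_admissible_if_gt:
  assumes "6/7 < \<delta>" "\<delta> \<le> 1"
  shows "STS_admissible \<epsilon> \<delta>"
  unfolding STS_admissible_def
\<comment> \<open>From 5 vertices on, the denominators n - 3 and n - 4 in \<open>inv_coeff\<close>
  are positive.\<close>
proof (intro exI[of _ 5] allI impI)
  fix n :: nat and V :: "nat set" and E
  assume n: "5 \<le> n"
    and H: "uniform3_hypergraph V E \<and> card V = n \<and>
        (1 - \<epsilon>) * (real n - 1) \<le> real (graph_min_degree V (shadow V E)) \<and>
        \<delta> * (real n - 2) \<le> real (ess_min_codegree V E)"
  show "\<exists>\<psi>. perfect_fractional_STS V E \<psi>"
  proof (rule perfect_fractional_STS_if_codegree[where x = "1 - \<delta>"])
    fix p assume "p \<in> shadow V E"
    then have "ess_min_codegree V E \<le> pair_deg E p"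
      using H by (intro ess_min_codegree_le) (auto simp: uniform3_hypergraph_def)
    then show "(1 - (1 - \<delta>)) * (real (card V) - 2) \<le> real (pair_deg E p)" using H by auto
  qed (use H n assms in auto)
qed

text \<open>The difference of the two values has the factor y - x, and the cofactor is positive
  because x + y < 1/3 makes 22 (x + y) less than 10.\<close>

lemma cubic_strict_mono:
  fixes x y :: real
  assumes "0 \<le> x" "x < y" "y \<le> 1/6"
  shows "8 * x^3 - 22 * x^2 + 10 * x - 1 < 8 * y^3 - 22 * y^2 + 10 * y - 1"
proof -
  have "0 < (y - x) * (8 * (x^2 + x * y + y^2) + (10 - 22 * (x + y)))"
    using assms by (intro mult_pos_pos add_nonneg_pos) auto
  then show ?thesis by (simp add: algebra_simps power2_eq_square power3_eq_cube)
qed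

lemma cubic_unique_root:
  "\<exists>!x::real. x \<in> {0..1/6} \<and> 8 * x^3 - 22 * x^2 + 10 * x - 1 = 0"
proof -
  have "\<exists>x::real. 0 \<le> x \<and> x \<le> 1/6 \<and> 8 * x^3 - 22 * x^2 + 10 * x - 1 = 0"
    \<comment> \<open>The cubic is -1 at 0 and 5/54 at 1/6.\<close>
    by (rule IVT') (auto intro!: continuous_intros simp: power2_eq_square power3_eq_cube)
  then obtain x :: real where x: "x \<in> {0..1/6}" "8 * x^3 - 22 * x^2 + 10 * x - 1 = 0" by auto
  moreover have "y = x" if "y \<in> {0..1/6}" "8 * y^3 - 22 * y^2 + 10 * y - 1 = 0" for y
    using cubic_strict_mono[of x y] cubic_strict_mono[of y x] that x
    by (cases x y rule: linorder_cases) auto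
  ultimately show ?thesis by blast
qed

text \<open>By monotonicity it suffices that the cubic is negative at 0.1421 = 1 - 0.8579 and
  positive at 1/7, where its value is 1/343.\<close>

lemma x_star_bounds: "0.1421 < x_star" "x_star < 1/7"
proof -
  have x: "x_star \<in> {0..1/6}" "8 * x_star^3 - 22 * x_star^2 + 10 * x_star - 1 = 0"
    using theI'[OF cubic_unique_root] by (auto simp: x_star_def)
  show "0.1421 < x_star"
  proof (rule ccontr)
    assume "\<not> 0.1421 < x_star"
    then consider "x_star = 0.1421" | "x_star < 0.1421" by linarith
    then show False
    proof cases
      case 1
      show False using x(2) unfolding 1 by (simp add: power2_eq_square power3_eq_cube)
    next
      case 2
      then show False
        using x cubic_strict_mono[of x_star "0.1421"]
        by (simp add: power2_eq_square power3_eq_cube)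
    qed
  qed
  show "x_star < 1/7"
  proof (rule ccontr)
    assume "\<not> x_star < 1/7"
    then consider "x_star = 1/7" | "1/7 < x_star" by linarith
    then show False
    proof cases
      case 1
      show False using x(2) unfolding 1 by (simp add: power2_eq_square power3_eq_cube)
    next
      case 2
      then show False
        using x cubic_strict_mono[of "1/7" x_star]
        by (simp add: power2_eq_square power3_eq_cube)
    qed
  qed
qed

theorem theorem1p14:
  shows "(\<exists>!x::real. x \<in> {0..1/6} \<and> 8 * x^3 - 22 * x^2 + 10 * x - 1 = 0)
    \<and> (\<forall>\<epsilon>\<in>{0..<1}. theta_STS_f \<epsilon> \<le> 1 - x_star)
    \<and> theta_STS_star \<le> 1 - x_star
    \<and> 1 - x_star < 0.8579"
proof -
  \<comment> \<open>As \<open>x_star\<close> < 1/7, the number \<open>1 - x_star\<close> exceeds 6/7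
    and so itself belongs to the set whose infimum is taken.\<close>
  have le: "theta_STS_f \<epsilon> \<le> 1 - x_star" for \<epsilon>
    unfolding theta_STS_f_def using x_star_bounds
    by (intro cInf_lower) (auto intro!: STS_admissible_if_gt bdd_belowI[of _ 0])
  then have "theta_STS_star \<le> 1 - x_star"
    by (intro tendsto_upperbound[OF tendsto_theta_STS_star]) auto
  with le x_star_bounds cubic_unique_root show ?thesis by auto
qed

end
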